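(* For every $0<\epsilon<1$ there exists a chore-allocation instance such that every allocation $(A_a)_{a\in\mathcal N}$ has some agent $a$ with $v_a(A_a)\ge(2-\epsilon)\,\mathsf{WMMS}_a$; that is, no allocation is $\alpha$-WMMS for any $\alpha<2-\epsilon$.
   Context: A chore-allocation instance consists of agents $\mathcal N$, a finite set $\mathcal M$ of indivisible items, positive weights $w_a$, and additive cost functions $v_a:2^{\mathcal M}\to\mathbb R_{\ge0}$. An allocation is an ordered partition of $\mathcal M$ into one (possibly empty) bundle $A_a$ per agent. The weighted maximin share of agent $a$ is $\mathsf{WMMS}_a=w_a\cdot\min_{\text{allocations }(B_b)_b}\max_{b\in\mathcal N}\frac{v_a(B_b)}{w_b}$. For $\alpha\ge1$, an allocation is $\alpha$-WMMS if $v_a(A_a)\le\alpha\,\mathsf{WMMS}_a$ for every agent $a$. *)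

theory Defs
  imports Complex_Main "HOL-Library.FuncSet"
begin

text \<open>Chore instance with agents {..<n} and items {..<m}; weights w; additive costs given by
  item costs c a j. An allocation is a map sigma from items to agents (extensional on {..<m}),
  and the bundle of agent b is the set of items assigned to b.\<close>

definition allocs :: "nat \<Rightarrow> nat \<Rightarrow> (nat \<Rightarrow> nat) set" where
  "allocs n m = PiE {..<m} (\<lambda>_. {..<n})"

definition bundle_of :: "(nat \<Rightarrow> nat) \<Rightarrow> nat \<Rightarrow> nat \<Rightarrow> nat set" where
  "bundle_of \<sigma> b m = {j \<in> {..<m}. \<sigma> j = b}"

definition cost :: "(nat \<Rightarrow> nat \<Rightarrow> real) \<Rightarrow> nat \<Rightarrow> nat set \<Rightarrow> real" where
  "cost c a S = (\<Sum>j\<in>S. c a j)"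

definition WMMS :: "nat \<Rightarrow> nat \<Rightarrow> (nat \<Rightarrow> real) \<Rightarrow> (nat \<Rightarrow> nat \<Rightarrow> real) \<Rightarrow> nat \<Rightarrow> real" where
  "WMMS n m w c a = w a * Min ((\<lambda>\<sigma>. Max ((\<lambda>b. cost c a (bundle_of \<sigma> b m) / w b) ` {..<n})) ` allocs n m)"

definition alpha_WMMS :: "real \<Rightarrow> nat \<Rightarrow> nat \<Rightarrow> (nat \<Rightarrow> real) \<Rightarrow> (nat \<Rightarrow> nat \<Rightarrow> real) \<Rightarrow> (nat \<Rightarrow> nat) \<Rightarrow> bool" where
  "alpha_WMMS \<alpha> n m w c \<sigma> \<longleftrightarrow> (\<forall>a<n. cost c a (bundle_of \<sigma> a m) \<le> \<alpha> * WMMS n m w c a)"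

end

theory Submission
  imports Defs
begin

text \<open>Agents come in levels \<open>k < K\<close> of total weights 1, 1, 2, 4, 8, ..., so that the levels
  \<open>\<le> k\<close> weigh \<open>2 ^ k\<close>, and items in classes \<open>j < K\<close>. Numbers of agents and of items grow so
  fast that level 0 has far fewer agents than class 0 has items, which are far fewer than the
  agents of level 1, and so on. For a level-\<open>k\<close> agent an item of a class \<open>j < k\<close> costs twice
  its weight, yet all these items together are negligible; every class \<open>j \<ge> k\<close> costs \<open>2 ^ k\<close> in
  total, in equal pieces, and fits: class \<open>k\<close> into the levels \<open>\<le> k\<close>, class \<open>j > k\<close> into level
  \<open>j\<close>. Hence WMMS is essentially the weight. If every agent stays below \<open>\<tau> \<le> 2\<close> times its weight,
  then level 0 takes less than \<open>\<tau>\<close> classes' worth of items and every other level less than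
  \<open>\<tau> / 2\<close>. As all \<open>K\<close> classes must be taken, \<open>\<tau> > 2 * K / (K + 1)\<close>.\<close>

section \<open>The instance: levels of agents and classes of items\<close>

definition mass :: "nat \<Rightarrow> nat" where
  "mass k = (if k = 0 then 1 else 2 ^ (k - 1))"

definition weight :: "nat \<Rightarrow> nat \<Rightarrow> real" where
  "weight q k = real (mass k) / real q ^ (2 * k)"

definition item_cost :: "nat \<Rightarrow> nat \<Rightarrow> nat \<Rightarrow> real" where
  "item_cost q k j = (if j < k then 2 * weight q k else 2 ^ k / real q ^ (2 * j + 1))"

text \<open>The exponents \<open>2 * k\<close> here and \<open>2 * j + 1\<close> in
  \<open>items\<close> interleave, so that every head count is \<open>q\<close> times the preceding
  one.\<close>

definition agents :: "nat \<Rightarrow> nat \<Rightarrow> (nat \<times> nat) set" where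
  "agents q K = (SIGMA k:{..<K}. {..<q ^ (2 * k)})"

definition items :: "nat \<Rightarrow> nat \<Rightarrow> (nat \<times> nat) set" where
  "items q K = (SIGMA j:{..<K}. {..<q ^ (2 * j + 1)})"

lemma sum_mass: "(\<Sum>k\<le>i. mass k) = 2 ^ i"
  by (induction i) (auto simp: mass_def)

lemma two_mass: "k > 0 \<Longrightarrow> 2 * real (mass k) = 2 ^ k"
  by (cases k) (auto simp: mass_def)

lemma weight_pos: "q > 0 \<Longrightarrow> weight q k > 0"
  by (auto simp: weight_def mass_def)

lemma item_cost_nonneg: "item_cost q k j \<ge> 0"
  by (auto simp: item_cost_def weight_def)

lemma finite_agents: "finite (agents q K)" and finite_items: "finite (items q K)"
  by (auto simp: agents_def items_def)

lemma sum_agents: "(\<Sum>a\<in>agents q K. h a) = (\<Sum>k<K. \<Sum>t<q ^ (2 * k). h (k, t))"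
  unfolding agents_def by (subst sum.Sigma) (auto simp: case_prod_unfold)

lemma sum_items: "(\<Sum>x\<in>items q K. h x) = (\<Sum>j<K. \<Sum>t<q ^ (2 * j + 1). h (j, t))"
  unfolding items_def by (subst sum.Sigma) (auto simp: case_prod_unfold)

text \<open>Open \<open>c b\<close> slots at every \<open>b\<close>, inject \<open>A\<close> into
  the slots and forget the slot numbers. This turns capacities per agent into a distribution of one
  class.\<close>

lemma ex_fun_card_fibres_le:
  assumes "finite A" "finite B" "card A \<le> (\<Sum>b\<in>B. c b)"
  shows "\<exists>f\<in>A \<rightarrow> B. \<forall>b\<in>B. card {a \<in> A. f a = b} \<le> c b"
proof -
  let ?S = "SIGMA b:B. {..<c b}"
  have "card A \<le> card ?S" "finite ?S"
    using assms by auto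
  then obtain h where h: "inj_on h A" "h ` A \<subseteq> ?S"
    using assms(1) by (metis card_le_inj)
  have "card {a \<in> A. fst (h a) = b} \<le> c b" if "b \<in> B" for b
  proof -
    have "card {a \<in> A. fst (h a) = b} \<le> card ({b} \<times> {..<c b})"
    proof (rule card_inj_on_le)
      show "inj_on h {a \<in> A. fst (h a) = b}"
        using h(1) by (rule inj_on_subset) auto
      show "h ` {a \<in> A. fst (h a) = b} \<subseteq> {b} \<times> {..<c b}"
        using h(2) by fastforce
    qed auto
    then show ?thesis by simp
  qed
  moreover have "(\<lambda>a. fst (h a)) \<in> A \<rightarrow> B"
    using h(2) by fastforce
  ultimately show ?thesis by (intro bexI[of _ "\<lambda>a. fst (h a)"]) auto
qed

section \<open>Every allocation overloads an agent\<close>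

text \<open>Double counting: give every item of class \<open>j\<close> the charge \<open>1 / q ^ (2 * j + 1)\<close>, so that
  each class has total charge 1. A level-\<open>k\<close> agent below the bound owns no item of a class
  \<open>j < k\<close>, hence owns charge less than \<open>1 / 2 ^ k\<close> times its bound.\<close>
lemma some_agent_overloaded:
  assumes "q > 0" "K > 0" and \<sigma>: "\<sigma> \<in> items q K \<rightarrow> agents q K"
  shows "\<exists>a\<in>agents q K. (\<Sum>x | x \<in> items q K \<and> \<sigma> x = a. item_cost q (fst a) (fst x))
           \<ge> 2 * real K / (real K + 1) * weight q (fst a)"
proof (rule ccontr)
  define \<tau> where "\<tau> = 2 * real K / (real K + 1)"
  have \<tau>: "0 < \<tau>" "\<tau> < 2" using assms by (auto simp: \<tau>_def field_simps)
  assume "\<not> ?thesis"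
  then have lt: "(\<Sum>x | x \<in> items q K \<and> \<sigma> x = a. item_cost q (fst a) (fst x)) < \<tau> * weight q (fst a)"
    if "a \<in> agents q K" for a
    using that by (auto simp: \<tau>_def not_le)
  define charge :: "nat \<times> nat \<Rightarrow> real" where "charge x = 1 / real q ^ (2 * fst x + 1)" for x
  have fin: "finite {x. x \<in> items q K \<and> \<sigma> x = a}" for a
    using finite_items by (rule finite_subset[rotated]) auto
  have charge_lt: "(\<Sum>x | x \<in> items q K \<and> \<sigma> x = a. charge x) < \<tau> * weight q (fst a) / 2 ^ fst a"
    if a: "a \<in> agents q K" for a
  proof -
    let ?X = "{x. x \<in> items q K \<and> \<sigma> x = a}"
    \<comment> \<open>One such item alone costs twice the weight, which exceeds the bound because
      \<open>\<tau> < 2\<close>.\<close>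
    have "\<not> fst x < fst a" if "x \<in> ?X" for x
    proof
      assume "fst x < fst a"
      then have "2 * weight q (fst a) = item_cost q (fst a) (fst x)"
        by (simp add: item_cost_def)
      also have "\<dots> \<le> (\<Sum>x\<in>?X. item_cost q (fst a) (fst x))"
        using that fin item_cost_nonneg by (intro member_le_sum) auto
      also have "\<dots> < \<tau> * weight q (fst a)" using lt[OF a] .
      also have "\<dots> < 2 * weight q (fst a)"
        using \<tau> weight_pos[OF assms(1)] by simp
      finally show False .
    qed
    then have "(\<Sum>x\<in>?X. item_cost q (fst a) (fst x)) = (\<Sum>x\<in>?X. 2 ^ fst a * charge x)"
      by (intro sum.cong refl) (simp add: item_cost_def charge_def)
    then have "2 ^ fst a * (\<Sum>x\<in>?X. charge x) < \<tau> * weight q (fst a)"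
      using lt[OF a] by (simp add: sum_distrib_left)
    then show ?thesis by (simp add: field_simps)
  qed
  have level: "real q ^ (2 * k) * (weight q k / 2 ^ k) = (if k = 0 then 1 else 1 / 2)" for k
    using assms(1) by (cases k) (auto simp: weight_def mass_def)
  have "real K = (\<Sum>j<K. \<Sum>t<q ^ (2 * j + 1). charge (j, t))"
    using assms(1) by (simp add: charge_def)
  also have "\<dots> = (\<Sum>x\<in>items q K. charge x)"
    by (simp add: sum_items)
  also have "\<dots> = (\<Sum>a\<in>agents q K. \<Sum>x | x \<in> items q K \<and> \<sigma> x = a. charge x)"
    using \<sigma> by (intro sum.group[symmetric] finite_items finite_agents) auto
  also have "\<dots> < (\<Sum>a\<in>agents q K. \<tau> * weight q (fst a) / 2 ^ fst a)"
  proof (rule sum_strict_mono)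
    have "(0, 0) \<in> agents q K" using assms by (auto simp: agents_def)
    then show "agents q K \<noteq> {}" by blast
  qed (use charge_lt finite_agents in auto)
  also have "\<dots> = (\<Sum>k<K. \<Sum>t<q ^ (2 * k). \<tau> * weight q k / 2 ^ k)"
    by (simp add: sum_agents)
  also have "\<dots> = \<tau> * (\<Sum>k<K. real q ^ (2 * k) * (weight q k / 2 ^ k))"
    by (simp add: sum_distrib_left mult_ac)
  also have "(\<Sum>k<K. real q ^ (2 * k) * (weight q k / 2 ^ k)) = (\<Sum>k<K. if k = 0 then 1 else 1 / 2)"
    unfolding level ..
  \<comment> \<open>Level 0 contributes 1 and the other \<open>K - 1\<close> levels 1/2 each;
    \<open>\<tau>\<close> is the factor that makes the product exactly \<open>K\<close>.\<close>
  also have "\<dots> = (real K + 1) / 2"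
    using assms(2) by (induction K rule: nat_induct_non_zero) (auto simp: field_simps)
  also have "\<tau> * ((real K + 1) / 2) = real K"
    by (simp add: \<tau>_def divide_simps)
  finally show False by simp
qed

section \<open>An upper bound on every agent's share\<close>

text \<open>\<open>B j i\<close> items of class \<open>j\<close> suffice per level-\<open>i\<close> agent; the forbidden items all go to the
  unique agent of level 0, which causes the excess \<open>1 / K\<close>.\<close>
lemma ex_balanced_plan:
  assumes "k < K" and q: "q = 2 ^ K * K ^ 2"
  shows "\<exists>P \<in> items q K \<rightarrow> agents q K. \<forall>b\<in>agents q K.
           (\<Sum>x | x \<in> items q K \<and> P x = b. item_cost q k (fst x)) \<le> (1 + 1 / real K) * weight q (fst b)"
proof -
  have q0: "q > 0" and K0: "K > 0" using assms by auto
  \<comment> \<open>Class \<open>k\<close> is divided in proportion to weight among the levels up to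
    \<open>k\<close>; a class \<open>j > k\<close> is divided equally within level \<open>j\<close>,
    giving \<open>q\<close> items to each agent.\<close>
  define B :: "nat \<Rightarrow> nat \<Rightarrow> nat" where
    "B j i = (if j < k then if i = 0 then q ^ (2 * j + 1) else 0
              else if j = k then if i \<le> k then mass i * q ^ (2 * (k - i)) * (q div 2 ^ k) else 0
              else if i = j then q else 0)" for j i
  \<comment> \<open>The factor \<open>2 ^ K\<close> of \<open>q\<close> makes this division exact,
    so the capacities lose nothing to rounding.\<close>
  have qk: "2 ^ k * (q div 2 ^ k) = q"
    using assms by (intro dvd_mult_div_cancel) (simp add: le_imp_power_dvd)
  have sum_B: "(\<Sum>b\<in>agents q K. B j (fst b)) = q ^ (2 * j + 1)" if j: "j < K" for j
  proof -
    have "(\<Sum>b\<in>agents q K. B j (fst b)) = (\<Sum>i<K. q ^ (2 * i) * B j i)"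
      by (simp add: sum_agents)
    also have "\<dots> = q ^ (2 * j + 1)"
    proof (cases j k rule: linorder_cases)
      case less
      then have "(\<Sum>i<K. q ^ (2 * i) * B j i) = (\<Sum>i<K. if i = 0 then q ^ (2 * j + 1) else 0)"
        by (intro sum.cong) (auto simp: B_def)
      then show ?thesis using K0 by simp
    next
      case equal
      have "(\<Sum>i<K. q ^ (2 * i) * B j i) = (\<Sum>i\<le>k. q ^ (2 * i) * B j i)"
        using assms(1) equal by (intro sum.mono_neutral_right) (auto simp: B_def)
      also have "\<dots> = (\<Sum>i\<le>k. mass i * (q ^ (2 * k) * (q div 2 ^ k)))"
      proof (intro sum.cong refl)
        fix i assume "i \<in> {..k}"
        then have "q ^ (2 * k) = q ^ (2 * i) * q ^ (2 * (k - i))"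
          by (metis atMost_iff distrib_left le_add_diff_inverse power_add)
        then show "q ^ (2 * i) * B j i = mass i * (q ^ (2 * k) * (q div 2 ^ k))"
          using equal \<open>i \<in> {..k}\<close> by (simp add: B_def)
      qed
      also have "\<dots> = q ^ (2 * k) * (2 ^ k * (q div 2 ^ k))"
        by (simp add: sum_distrib_right[symmetric] sum_mass)
      finally show ?thesis using equal qk by simp
    next
      case greater
      then have "(\<Sum>i<K. q ^ (2 * i) * B j i) = (\<Sum>i<K. if i = j then q ^ (2 * j + 1) else 0)"
        by (intro sum.cong) (auto simp: B_def)
      then show ?thesis using j by simp
    qed
    finally show ?thesis .
  qed
  define spread where "spread j f \<longleftrightarrow> f \<in> {..<q ^ (2 * j + 1)} \<rightarrow> agents q K \<and>
      (\<forall>b\<in>agents q K. card {t \<in> {..<q ^ (2 * j + 1)}. f t = b} \<le> B j (fst b))" for j f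
  have "\<exists>f. spread j f" if "j < K" for j
    unfolding spread_def Bex_def[symmetric]
    using sum_B[OF that] by (intro ex_fun_card_fibres_le finite_agents) auto
  then obtain f where spread: "\<And>j. j < K \<Longrightarrow> spread j (f j)" by metis
  \<comment> \<open>Only class \<open>max i k\<close> fills a level-\<open>i\<close> agent. Each
    forbidden class adds at most \<open>1 / K ^ 2\<close> at level 0, hence less than
    \<open>1 / K\<close> over all of them.\<close>
  have term_le: "real (B j i) * item_cost q k j
      \<le> (if i = 0 then 1 / real K ^ 2 else 0) + (if j = max i k then weight q i else 0)"
    if "j < K" for i j
  proof (cases j k rule: linorder_cases)
    case less
    \<comment> \<open>As \<open>j < k\<close>, the class has at most \<open>q ^ (2 * k - 1)\<close>
      items, which leaves \<open>2 ^ k / q\<close>; the factor \<open>K ^ 2\<close> of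
      \<open>q\<close> is there for this bound.\<close>
    have "real q ^ (2 * j + 1) * (2 * weight q k) \<le> 1 / real K ^ 2"
    proof -
      have "real q ^ (2 * j + 1) * (2 * weight q k) = 2 ^ k * real q ^ (2 * j + 1) / real q ^ (2 * k)"
        using two_mass[of k] less by (simp add: weight_def)
      also have "\<dots> \<le> 2 ^ k * real q ^ (2 * k - 1) / real q ^ (2 * k)"
        using less q0 by (intro divide_right_mono mult_left_mono power_increasing) auto
      also have "\<dots> = 2 ^ k / real q"
        using less q0 by (cases k) (auto simp: field_simps)
      also have "\<dots> \<le> 2 ^ K / real q"
        using assms(1) by (intro divide_right_mono power_increasing) auto
      also have "\<dots> = 1 / real K ^ 2"
        using K0 by (simp add: q)
      finally show ?thesis .
    qed
    then show ?thesis using less by (auto simp: B_def item_cost_def)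
  next
    case equal
    show ?thesis
    proof (cases "i \<le> k")
      case True
      have "real q ^ (2 * k) = real q ^ (2 * i) * real q ^ (2 * (k - i))"
        using True by (metis distrib_left le_add_diff_inverse power_add)
      moreover have "2 ^ k * real (q div 2 ^ k) = real q"
        using arg_cong[OF qk, of real] by simp
      ultimately have "real (B j i) * item_cost q k j = weight q i"
        using q0 True equal by (simp add: B_def item_cost_def weight_def field_simps)
      then show ?thesis using True equal by auto
    qed (use equal in \<open>auto simp: B_def weight_def\<close>)
  next
    case greater
    \<comment> \<open>Here \<open>j > k\<close>, so \<open>mass j\<close> is
      \<open>2 ^ (j - 1)\<close> with \<open>j - 1 \<ge> k\<close>.\<close>
    have "(2::real) ^ k \<le> real (mass j)"
      using greater by (auto simp: mass_def intro!: power_increasing)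
    then have "2 ^ k / real q ^ (2 * j) \<le> weight q j"
      by (simp add: weight_def divide_right_mono)
    then show ?thesis
      using greater q0 by (auto simp: B_def item_cost_def weight_def)
  qed
  let ?P = "\<lambda>x. f (fst x) (snd x)"
  have "(\<Sum>x | x \<in> items q K \<and> ?P x = b. item_cost q k (fst x)) \<le> (1 + 1 / real K) * weight q (fst b)"
    if b: "b \<in> agents q K" for b
  proof -
    have "{x. x \<in> items q K \<and> ?P x = b} = (SIGMA j:{..<K}. {t \<in> {..<q ^ (2 * j + 1)}. f j t = b})"
      by (auto simp: items_def)
    then have "(\<Sum>x | x \<in> items q K \<and> ?P x = b. item_cost q k (fst x))
        = (\<Sum>j<K. \<Sum>t\<in>{t \<in> {..<q ^ (2 * j + 1)}. f j t = b}. item_cost q k j)"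
      by (simp only:) (subst sum.Sigma, auto simp: case_prod_unfold)
    also have "\<dots> \<le> (\<Sum>j<K. real (B j (fst b)) * item_cost q k j)"
      using spread b item_cost_nonneg by (auto simp: spread_def intro!: sum_mono mult_right_mono)
    also have "\<dots> \<le> (\<Sum>j<K. (if fst b = 0 then 1 / real K ^ 2 else 0)
                      + (if j = max (fst b) k then weight q (fst b) else 0))"
      using term_le by (intro sum_mono) auto
    also have "\<dots> = (if fst b = 0 then 1 / real K else 0) + weight q (fst b)"
      using assms(1) b by (auto simp: sum.distrib power2_eq_square agents_def)
    \<comment> \<open>The level-0 agent has weight 1, so its additive excess is also the relative
      one.\<close>
    also have "\<dots> \<le> (1 + 1 / real K) * weight q (fst b)"
    proof (cases "fst b = 0")
      case True
      then show ?thesis by (simp add: weight_def mass_def)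
    next
      case False
      then show ?thesis using weight_pos[OF q0, of "fst b"] by (simp add: algebra_simps)
    qed
    finally show ?thesis .
  qed
  moreover have "?P \<in> items q K \<rightarrow> agents q K"
    using spread by (auto simp: spread_def items_def Pi_def)
  ultimately show ?thesis by (intro bexI[of _ ?P] ballI)
qed

section \<open>Passage to numbered agents and items\<close>

lemma WMMS_le:
  assumes "n > 0" "a < n" "w a \<ge> 0" "\<And>b. b < n \<Longrightarrow> w b > 0" "\<sigma> \<in> allocs n m"
    and "\<And>b. b < n \<Longrightarrow> cost c a (bundle_of \<sigma> b m) \<le> U * w b"
  shows "WMMS n m w c a \<le> U * w a"
proof -
  let ?M = "\<lambda>\<sigma>. Max ((\<lambda>b. cost c a (bundle_of \<sigma> b m) / w b) ` {..<n})"
  have "finite (allocs n m)" by (auto simp: allocs_def intro!: finite_PiE)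
  then have "Min (?M ` allocs n m) \<le> ?M \<sigma>"
    using assms(5) by (intro Min_le) auto
  also have "\<dots> \<le> U"
    using assms by (subst Max_le_iff) (auto simp: field_simps)
  finally show ?thesis
    using assms(3) by (simp add: WMMS_def mult.commute[of U] mult_left_mono)
qed

text \<open>Since \<open>f\<close> is injective, \<open>g\<close> maps the bundle of
  \<open>a\<close> onto the fibre of \<open>P\<close> over \<open>f a\<close>.\<close>

lemma cost_bundle_transfer:
  assumes f: "bij_betw f {..<n} A" and g: "bij_betw g {..<m} X" and a: "a < n"
    and \<sigma>: "\<And>j. j < m \<Longrightarrow> \<sigma> j < n" and P: "\<And>j. j < m \<Longrightarrow> P (g j) = f (\<sigma> j)"
    and c: "\<And>j. j < m \<Longrightarrow> c a j = h (g j)"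
  shows "cost c a (bundle_of \<sigma> a m) = (\<Sum>x | x \<in> X \<and> P x = f a. h x)"
proof -
  have "bij_betw g (bundle_of \<sigma> a m) {x. x \<in> X \<and> P x = f a}"
  proof (rule bij_betw_subset[OF g])
    show "g ` bundle_of \<sigma> a m = {x. x \<in> X \<and> P x = f a}"
    proof (intro equalityI subsetI)
      fix x assume x: "x \<in> {x. x \<in> X \<and> P x = f a}"
      then obtain j where j: "j < m" "x = g j"
        using g by (auto simp: bij_betw_def)
      then have "f (\<sigma> j) = f a" using x P by auto
      then have "\<sigma> j = a" using f \<sigma>[OF j(1)] a by (auto simp: bij_betw_def dest: inj_onD)
      then show "x \<in> g ` bundle_of \<sigma> a m" using j by (auto simp: bundle_of_def)
    qed (use g P in \<open>auto simp: bundle_of_def bij_betw_def\<close>)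
  qed (auto simp: bundle_of_def)
  from sum.reindex_bij_betw[OF this, of h] show ?thesis
    using c by (auto simp: cost_def bundle_of_def)
qed

theorem theorem5p1:
  fixes \<epsilon> :: real
  assumes "0 < \<epsilon>" and "\<epsilon> < 1"
  shows "\<exists>(n::nat) (m::nat) (w::nat \<Rightarrow> real) (c::nat \<Rightarrow> nat \<Rightarrow> real).
           n \<ge> 1 \<and> (\<forall>a<n. w a > 0) \<and> (\<forall>a<n. \<forall>j<m. c a j \<ge> 0) \<and>
           (\<forall>\<sigma>\<in>allocs n m. \<exists>a<n. cost c a (bundle_of \<sigma> a m) \<ge> (2 - \<epsilon>) * WMMS n m w c a) \<and>
           (\<forall>\<alpha>::real. 1 \<le> \<alpha> \<and> \<alpha> < 2 - \<epsilon> \<longrightarrow> (\<forall>\<sigma>\<in>allocs n m. \<not> alpha_WMMS \<alpha> n m w c \<sigma>))"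
proof -
  obtain K :: nat where K: "real K > 4 / \<epsilon>" using reals_Archimedean2 by blast
  have K0: "K > 0" using K assms by (cases K) (auto simp: divide_simps)
  define q where "q = 2 ^ K * K ^ 2"
  have q0: "q > 0" using K0 by (simp add: q_def)
  define U where "U = 1 + 1 / real K"
  \<comment> \<open>After clearing denominators this reads
    \<open>4 * K + 2 \<le> \<epsilon> * (K + 1) ^ 2\<close>, which follows from
    \<open>\<epsilon> * K > 4\<close>.\<close>
  have U: "(2 - \<epsilon>) * U \<le> 2 * real K / (real K + 1)"
  proof -
    have "(2 - \<epsilon>) * (real K + 1) * (real K + 1) \<le> 2 * real K * real K"
    proof -
      have "4 < \<epsilon> * real K" using K assms by (simp add: field_simps)
      then have "4 * real K + 4 \<le> \<epsilon> * real K * (real K + 1)"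
        using mult_right_mono[of 4 "\<epsilon> * real K" "real K + 1"] by (simp add: algebra_simps)
      moreover have "0 \<le> \<epsilon> * (real K + 1)" using assms by simp
      ultimately show ?thesis by (simp add: algebra_simps)
    qed
    then show ?thesis using K0 by (simp add: U_def divide_simps)
  qed
  define n where "n = card (agents q K)"
  define m where "m = card (items q K)"
  obtain f where f: "bij_betw f {..<n} (agents q K)"
    using ex_bij_betw_nat_finite[OF finite_agents] by (metis n_def atLeast0LessThan)
  obtain g where g: "bij_betw g {..<m} (items q K)"
    using ex_bij_betw_nat_finite[OF finite_items] by (metis m_def atLeast0LessThan)
  define w where "w a = weight q (fst (f a))" for a
  define c where "c a j = item_cost q (fst (f a)) (fst (g j))" for a j
  have f_in: "f a \<in> agents q K" if "a < n" for a using f that by (auto simp: bij_betw_def)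
  have g_in: "g j \<in> items q K" if "j < m" for j using g that by (auto simp: bij_betw_def)
  have w_pos: "w a > 0" for a using weight_pos[OF q0] by (simp add: w_def)
  have n: "n \<ge> 1"
  proof -
    have "(0, 0) \<in> agents q K" using q0 K0 by (auto simp: agents_def)
    then show ?thesis using finite_agents by (auto simp: n_def Suc_le_eq card_gt_0_iff)
  qed
  have WMMS: "WMMS n m w c a \<le> U * w a" if a: "a < n" for a
  proof -
    have "fst (f a) < K" using f_in[OF a] by (auto simp: agents_def)
    from ex_balanced_plan[OF this q_def] obtain P
      where P: "P \<in> items q K \<rightarrow> agents q K"
        and P_le: "\<And>b. b \<in> agents q K \<Longrightarrow>
          (\<Sum>x | x \<in> items q K \<and> P x = b. item_cost q (fst (f a)) (fst x)) \<le> U * weight q (fst b)"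
      unfolding U_def by blast
    define \<sigma> where "\<sigma> = restrict (\<lambda>j. inv_into {..<n} f (P (g j))) {..<m}"
    have P\<sigma>: "\<sigma> j < n" "P (g j) = f (\<sigma> j)" if "j < m" for j
    proof -
      have "P (g j) \<in> f ` {..<n}" using P g_in[OF that] f by (auto simp: bij_betw_def)
      then show "\<sigma> j < n" "P (g j) = f (\<sigma> j)"
        using that inv_into_into[of "P (g j)" f "{..<n}"] by (auto simp: \<sigma>_def f_inv_into_f)
    qed
    show ?thesis
    proof (rule WMMS_le[where \<sigma> = \<sigma>])
      show "\<sigma> \<in> allocs n m" using P\<sigma>(1) by (auto simp: allocs_def \<sigma>_def)
      fix b assume b: "b < n"
      \<comment> \<open>The transfer lemma uses one index for both the valuing agent and the owner;
        a constant cost family separates the two.\<close>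
      have "cost c a (bundle_of \<sigma> b m) = cost (\<lambda>_. c a) b (bundle_of \<sigma> b m)"
        by (simp add: cost_def)
      also have "\<dots> = (\<Sum>x | x \<in> items q K \<and> P x = f b. item_cost q (fst (f a)) (fst x))"
        using P\<sigma> by (intro cost_bundle_transfer[OF f g b]) (auto simp: c_def)
      also have "\<dots> \<le> U * w b" using P_le[OF f_in[OF b]] by (simp add: w_def)
      finally show "cost c a (bundle_of \<sigma> b m) \<le> U * w b" .
    qed (use a n w_pos less_imp_le in auto)
  qed
  \<comment> \<open>Comparing with \<open>U * w a\<close>, which is visibly positive, later yields a
    strict inequality for \<open>\<alpha> < 2 - \<epsilon>\<close> without showing that
    \<open>WMMS\<close> is positive.\<close>
  have ex_overloaded: "\<exists>a<n. cost c a (bundle_of \<sigma> a m) \<ge> (2 - \<epsilon>) * (U * w a)"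
    if \<sigma>: "\<sigma> \<in> allocs n m" for \<sigma>
  proof -
    define P where "P x = f (\<sigma> (inv_into {..<m} g x))" for x
    have \<sigma>n: "\<sigma> j < n" if "j < m" for j using \<sigma> that by (auto simp: allocs_def)
    have Pg: "P (g j) = f (\<sigma> j)" if "j < m" for j
      using g that by (simp add: P_def bij_betw_def)
    have "P \<in> items q K \<rightarrow> agents q K"
    proof
      fix x assume "x \<in> items q K"
      then obtain j where "j < m" "x = g j" using g by (auto simp: bij_betw_def)
      then show "P x \<in> agents q K" using f_in \<sigma>n Pg by simp
    qed
    from some_agent_overloaded[OF q0 K0 this] obtain a where a: "a < n"
      and ge: "2 * real K / (real K + 1) * w a
        \<le> (\<Sum>x | x \<in> items q K \<and> P x = f a. item_cost q (fst (f a)) (fst x))"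
      unfolding bij_betw_imp_surj_on[OF f, symmetric] by (auto simp: w_def)
    have "(2 - \<epsilon>) * (U * w a) \<le> 2 * real K / (real K + 1) * w a"
      using mult_right_mono[OF U, of "w a"] w_pos[of a] by (simp add: mult.assoc)
    also note ge
    also have "(\<Sum>x | x \<in> items q K \<and> P x = f a. item_cost q (fst (f a)) (fst x))
        = cost c a (bundle_of \<sigma> a m)"
      using Pg \<sigma>n by (intro cost_bundle_transfer[OF f g a, symmetric]) (auto simp: c_def)
    finally show ?thesis using a by blast
  qed
  have "\<exists>a<n. cost c a (bundle_of \<sigma> a m) \<ge> (2 - \<epsilon>) * WMMS n m w c a"
    if \<sigma>: "\<sigma> \<in> allocs n m" for \<sigma>
  proof -
    from ex_overloaded[OF \<sigma>] obtain a where a: "a < n"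
      "cost c a (bundle_of \<sigma> a m) \<ge> (2 - \<epsilon>) * (U * w a)" by blast
    moreover have "(2 - \<epsilon>) * WMMS n m w c a \<le> (2 - \<epsilon>) * (U * w a)"
      using WMMS[OF a(1)] assms by (intro mult_left_mono) auto
    ultimately show ?thesis by (intro exI[of _ a]) auto
  qed
  moreover have "\<not> alpha_WMMS \<alpha> n m w c \<sigma>"
    if \<alpha>: "1 \<le> \<alpha>" "\<alpha> < 2 - \<epsilon>" and \<sigma>: "\<sigma> \<in> allocs n m" for \<alpha> \<sigma>
  proof -
    from ex_overloaded[OF \<sigma>] obtain a where a: "a < n"
      "cost c a (bundle_of \<sigma> a m) \<ge> (2 - \<epsilon>) * (U * w a)" by blast
    have "\<alpha> * WMMS n m w c a \<le> \<alpha> * (U * w a)"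
      using WMMS[OF a(1)] \<alpha> by (intro mult_left_mono) auto
    also have "\<dots> < (2 - \<epsilon>) * (U * w a)"
      using \<alpha> w_pos[of a] by (intro mult_strict_right_mono) (auto simp: U_def add_pos_nonneg)
    finally show ?thesis using a unfolding alpha_WMMS_def by (meson not_le order.strict_trans2)
  qed
  moreover have "c a j \<ge> 0" for a j by (simp add: c_def item_cost_nonneg)
  ultimately show ?thesis using n w_pos by blast
qed

end
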